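(* Let $\alpha$ and $\beta$ be constants with $1/(2\epsilon)\ge\alpha\ge 0$ and $\beta\ge 0$. Any fair algorithm that w.h.p. in $\eta$ solves the static wakeup problem with $O(\mathcal{C}^{\frac12+\alpha\epsilon}\log^{\beta} n)$ latency has, w.h.p., an expected collision cost of $\Omega(\mathcal{C}^{\frac12-\alpha\epsilon}/\log^{\beta} n)$.
   Context: Model: there are $n$ packets ($n$ large and unknown to the packets), all active from slot 1 (static setting) on a slotted multiple access channel: in each slot each packet sends or listens; exactly one sender is a success, two or more senders is a collision (no packet succeeds), no sender is an empty slot; there is no collision detection, no identifiers, no central coordinator. The wakeup problem is solved at the first success; latency is the number of slots until the first success. Each collision costs a known value $\mathcal{C}\ge 4$ chosen by an adversary knowing $n$, with $\mathcal{C}=O(\mathrm{poly}(n))$; collision cost is $\mathcal{C}$ times the number of collisions. $\eta=\max\{n,\mathcal{C}\}$. W.h.p. in $x$ means with probability at least $1-O(1/\mathrm{poly}(x))$ for an arbitrarily large constant degree. $\epsilon$ is a small positive constant. A fair algorithm is specified by a sequence $p_1,p_2,\dots$ where every packet sends with probability $p_i$ (independently) in the $i$-th slot. *)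

theory Defs
  imports "HOL-Probability.Probability" "HOL-Library.Landau_Symbols"
begin

text \<open>
  A fair algorithm is a function \<open>p\<close>: when a collision costs \<open>C\<close>, every packet sends with
  probability \<open>p C i\<close> in slot \<open>i \<ge> 1\<close>. The packets know \<open>C\<close> but not their number \<open>n\<close>, hence
  \<open>n\<close> is not an argument of \<open>p\<close>.
\<close>

definition fair_algorithm :: "(real \<Rightarrow> nat \<Rightarrow> real) \<Rightarrow> bool" where
  "fair_algorithm p \<longleftrightarrow> (\<forall>C i. 0 \<le> p C i \<and> p C i \<le> 1)"

definition slot_pmf :: "nat \<Rightarrow> real \<Rightarrow> (nat \<Rightarrow> bool) pmf" where
  "slot_pmf n q = Pi_pmf {..<n} False (\<lambda>_. bernoulli_pmf q)"

text \<open>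
  In a run \<open>\<omega>\<close>, the value \<open>\<omega> i j\<close> tells whether packet \<open>j < n\<close> sends in slot \<open>i \<ge> 1\<close>. Send
  decisions continue to be sampled after the first success; the latency and the collision cost
  below depend only on the slots up to the first success.
\<close>

definition run_space :: "nat \<Rightarrow> (nat \<Rightarrow> real) \<Rightarrow> (nat \<Rightarrow> nat \<Rightarrow> bool) measure" where
  "run_space n q = (\<Pi>\<^sub>M i\<in>{1..}. measure_pmf (slot_pmf n (q i)))"

definition num_senders :: "nat \<Rightarrow> (nat \<Rightarrow> nat \<Rightarrow> bool) \<Rightarrow> nat \<Rightarrow> nat" where
  "num_senders n \<omega> i = card {j. j < n \<and> \<omega> i j}"

definition success :: "nat \<Rightarrow> (nat \<Rightarrow> nat \<Rightarrow> bool) \<Rightarrow> nat \<Rightarrow> bool" where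
  "success n \<omega> i \<longleftrightarrow> num_senders n \<omega> i = 1"

definition collision :: "nat \<Rightarrow> (nat \<Rightarrow> nat \<Rightarrow> bool) \<Rightarrow> nat \<Rightarrow> bool" where
  "collision n \<omega> i \<longleftrightarrow> num_senders n \<omega> i \<ge> 2"

text \<open>The latency is \<open>\<infinity>\<close> if no slot is successful.\<close>

definition latency :: "nat \<Rightarrow> (nat \<Rightarrow> nat \<Rightarrow> bool) \<Rightarrow> enat" where
  "latency n \<omega> = (INF i\<in>{i. 1 \<le> i \<and> success n \<omega> i}. enat i)"

definition solved_within :: "nat \<Rightarrow> (nat \<Rightarrow> real) \<Rightarrow> nat \<Rightarrow> (nat \<Rightarrow> nat \<Rightarrow> bool) set" where
  "solved_within n q t = {\<omega> \<in> space (run_space n q). latency n \<omega> \<le> enat t}"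

text \<open>
  A run without success may have infinitely many collisions, so costs and expected costs are
  extended reals: \<open>card\<close> and the Bochner integral would turn infinite values into \<open>0\<close>.
\<close>

definition collision_cost :: "real \<Rightarrow> nat \<Rightarrow> (nat \<Rightarrow> nat \<Rightarrow> bool) \<Rightarrow> ennreal" where
  "collision_cost C n \<omega> =
     ennreal C * emeasure (count_space UNIV) {i. 1 \<le> i \<and> enat i < latency n \<omega> \<and> collision n \<omega> i}"

definition expected_cost :: "real \<Rightarrow> nat \<Rightarrow> (nat \<Rightarrow> real) \<Rightarrow> ennreal" where
  "expected_cost C n q = (\<integral>\<^sup>+\<omega>. collision_cost C n \<omega> \<partial>run_space n q)"

definition expected_cost_given ::
  "(nat \<Rightarrow> nat \<Rightarrow> bool) set \<Rightarrow> real \<Rightarrow> nat \<Rightarrow> (nat \<Rightarrow> real) \<Rightarrow> ennreal" where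
  "expected_cost_given A C n q =
     (\<integral>\<^sup>+\<omega>. collision_cost C n \<omega> \<partial>uniform_measure (run_space n q) A)"

text \<open>The number of packets \<open>n\<close> is the asymptotic parameter; \<open>d\<close> is the degree of the polynomial.\<close>

definition whp :: "real \<Rightarrow> (nat \<Rightarrow> real) \<Rightarrow> (nat \<Rightarrow> 'a measure) \<Rightarrow> (nat \<Rightarrow> 'a set) \<Rightarrow> bool" where
  "whp d x M A \<longleftrightarrow> (\<lambda>n. 1 - measure (M n) (A n)) \<in> O(\<lambda>n. x n powr (- d))"

definition ennreal_bigomega :: "(nat \<Rightarrow> ennreal) \<Rightarrow> (nat \<Rightarrow> real) \<Rightarrow> bool" where
  "ennreal_bigomega f g \<longleftrightarrow> (\<exists>c>0. \<forall>\<^sub>F n in sequentially. ennreal (c * g n) \<le> f n)"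

end

theory Submission imports Defs begin

text \<open>
  Let \<open>s i\<close> and \<open>k i\<close> be the probabilities of a success and of a collision in slot \<open>i\<close>, and
  \<open>w i\<close> the probability that no earlier slot, but some later slot up to \<open>T\<close>, is successful.
  The binomial distribution satisfies \<open>(s i)\<^sup>2 \<le> 4 * k i\<close>, whence also \<open>s i \<le> 9/10\<close>. The sum of
  \<open>w i * s i\<close> over the slots up to \<open>T\<close> is the probability of at least two successes up to \<open>T\<close>,
  which is at least \<open>1/2\<close> when failure within \<open>T\<close> slots is
  unlikely: as \<open>s i \<le> 9/10\<close>, a single success is then unlikely too. By Cauchy--Schwarz the sum of \<open>w i * k i\<close> is then at least \<open>1 / (16 * T)\<close>, and the
  collisions it counts all occur in runs that succeed within \<open>T\<close> slots. Hence \<open>C / (16 * T)\<close>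
  bounds both the unconditional and the conditional expected cost from below.
\<close>

section \<open>Inequalities for sequences of success and collision probabilities\<close>

lemma sum_first_success:
  fixes s :: "nat \<Rightarrow> real"
  shows "(\<Sum>i=1..T. (\<Prod>j=1..<i. 1 - s j) * s i) = 1 - (\<Prod>j=1..T. 1 - s j)"
proof (induction T)
  case (Suc T)
  have "{1..<Suc T} = {1..T}" by auto
  with Suc show ?case by (simp add: algebra_simps)
qed simp

text \<open>With product \<open>F\<close> and sum \<open>S\<close>, \<open>F \<le> exp (- S)\<close>
  gives \<open>sqrt F * S \<le> S * exp (- S / 2) \<le> 2\<close>; the second factor
  \<open>sqrt F\<close> is kept. Thus a small \<open>F\<close> makes \<open>F * S\<close> small
  however large \<open>S\<close> is.\<close>

lemma prod_failure_mult_sum_le: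
  fixes s :: "'a \<Rightarrow> real"
  assumes s: "\<And>i. i \<in> A \<Longrightarrow> s i \<le> 1"
  shows "(\<Prod>i\<in>A. 1 - s i) * (\<Sum>i\<in>A. s i) \<le> 2 * sqrt (\<Prod>i\<in>A. 1 - s i)"
proof -
  define F S where "F = (\<Prod>i\<in>A. 1 - s i)" and "S = (\<Sum>i\<in>A. s i)"
  have F0: "0 \<le> F" unfolding F_def using s by (intro prod_nonneg) auto
  have "F \<le> exp (- S)"
  proof (cases "finite A")
    case True
    have "F \<le> (\<Prod>i\<in>A. exp (- s i))"
      unfolding F_def using s exp_ge_add_one_self[of "- s _"] by (intro prod_mono) auto
    also have "\<dots> = exp (- S)"
      using True by (simp add: S_def exp_sum sum_negf [symmetric])
    finally show ?thesis .
  \<comment> \<open>For infinite \<open>A\<close> the product defaults to 1 and the sum to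
    0.\<close>
  qed (simp add: F_def S_def)
  then have "sqrt F \<le> sqrt (exp (- S))" by simp
  also have "sqrt (exp (- S)) = exp (- S / 2)"
    by (rule real_sqrt_unique) (simp_all flip: exp_double)
  finally have le: "sqrt F \<le> exp (- S / 2)" .
  have "sqrt F * S \<le> 2"
  proof (cases "S \<le> 0")
    case True
    then have "sqrt F * S \<le> 0" using F0 by (simp add: mult_nonneg_nonpos)
    then show ?thesis by simp
  next
    case False
    have "S \<le> 2 * exp (S / 2)" using exp_ge_add_one_self[of "S / 2"] by linarith
    with le False have "sqrt F * S \<le> exp (- S / 2) * (2 * exp (S / 2))"
      by (intro mult_mono) auto
    also have "\<dots> = 2" by (simp flip: exp_add)
    finally show ?thesis .
  qed
  then have "sqrt F * (sqrt F * S) \<le> sqrt F * 2"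
    using F0 by (intro mult_left_mono) auto
  moreover have "sqrt F * (sqrt F * S) = F * S"
    using F0 by (simp flip: mult.assoc)
  ultimately have "F * S \<le> 2 * sqrt F" by linarith
  then show ?thesis by (simp only: F_def S_def)
qed

lemma weighted_collision_lower_bound:
  fixes s k :: "nat \<Rightarrow> real"
  assumes s0: "\<And>i. 0 \<le> s i" and s1: "\<And>i. s i \<le> 9 / 10"
    and k: "\<And>i. (s i)\<^sup>2 \<le> 4 * k i"
    and F: "(\<Prod>j=1..T. 1 - s j) \<le> 1 / 10000"
  shows "1 / (16 * real T) \<le>
    (\<Sum>i=1..T. (\<Prod>j=1..<i. 1 - s j) * k i * (1 - (\<Prod>j\<in>{i<..T}. 1 - s j)))"
proof -
  define F where "F = (\<Prod>j=1..T. 1 - s j)"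
  define P where "P i = (\<Prod>j=1..<i. 1 - s j)" for i
  define Q where "Q i = (\<Prod>j\<in>{i<..T}. 1 - s j)" for i
  define w where "w i = P i * (1 - Q i)" for i
  have s1': "0 \<le> 1 - s i" "1 - s i \<le> 1" for i using s0[of i] s1[of i] by auto
  have P: "0 \<le> P i" "P i \<le> 1" for i
    unfolding P_def using s1' by (auto intro: prod_nonneg prod_le_1)
  have Q: "0 \<le> Q i" "Q i \<le> 1" for i
    unfolding Q_def using s1' by (auto intro: prod_nonneg prod_le_1)
  have F0: "0 \<le> F" unfolding F_def using s1' by (auto intro: prod_nonneg)
  have w: "0 \<le> w i" "w i \<le> 1" for i
    unfolding w_def using P[of i] Q[of i] by (auto intro: mult_le_one)
  \<comment> \<open>For \<open>T = 0\<close> the product is empty and equals 1, contrary to the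
    bound \<open>1 / 10000\<close>.\<close>
  have T: "real T > 0" using F by (cases T) auto
  \<comment> \<open>\<open>P i * Q i\<close> lacks only the factor \<open>1 - s i\<close> of
    \<open>F\<close>, which is at least \<open>1 / 10\<close>. This controls
    \<open>P i * Q i * s i\<close>, the probability that slot \<open>i\<close> is the only
    success.\<close>
  have PQ: "P i * Q i \<le> 10 * F" if "i \<in> {1..T}" for i
  proof -
    have "{1..T} = {1..<i} \<union> ({i} \<union> {i<..T})" using that by auto
    then have "F = (\<Prod>j\<in>{1..<i} \<union> ({i} \<union> {i<..T}). 1 - s j)" by (simp only: F_def)
    also have "\<dots> = P i * ((1 - s i) * Q i)"
      unfolding P_def Q_def by (subst prod.union_disjoint; force)+
    finally have "F = (P i * Q i) * (1 - s i)" by (simp add: mult_ac)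
    moreover have "(P i * Q i) * (1 / 10) \<le> (P i * Q i) * (1 - s i)"
      using P[of i] Q[of i] s1[of i] by (intro mult_left_mono) auto
    ultimately show ?thesis by simp
  qed
  \<comment> \<open>The threshold \<open>1 / 10000\<close> is chosen so that
    \<open>10 * (2 * sqrt F) \<le> 1 / 5\<close>: a single success accounts for at most that much of
    \<open>1 - F\<close>.\<close>
  have "sqrt F \<le> sqrt ((1 / 100)\<^sup>2)" using F by (intro real_sqrt_le_mono) (simp add: F_def power2_eq_square)
  then have sF: "sqrt F \<le> 1 / 100" by simp
  have "F * (\<Sum>i=1..T. s i) \<le> 2 * sqrt F"
    unfolding F_def by (rule prod_failure_mult_sum_le) (use s1' in force)
  then have FS: "(\<Sum>i=1..T. 10 * F * s i) \<le> 1 / 5"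
    using sF by (simp add: mult.assoc flip: sum_distrib_left)
  have "(\<Sum>i=1..T. P i * Q i * s i) \<le> (\<Sum>i=1..T. 10 * F * s i)"
    by (intro sum_mono mult_right_mono PQ s0)
  moreover have "(\<Sum>i=1..T. w i * s i) = (\<Sum>i=1..T. P i * s i) - (\<Sum>i=1..T. P i * Q i * s i)"
    by (simp add: w_def algebra_simps flip: sum_subtractf)
  moreover have "(\<Sum>i=1..T. P i * s i) = 1 - F"
    unfolding P_def F_def by (rule sum_first_success)
  ultimately have "1 / 2 \<le> (\<Sum>i=1..T. w i * s i)"
    using FS F[folded F_def] by linarith
  also have "\<dots> \<le> (\<Sum>i=1..T. real T * (4 * (w i * k i)) + 1 / (4 * real T))"
  proof (intro sum_mono)
    fix i
    \<comment> \<open>AM--GM in place of Cauchy--Schwarz\<close>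
    have "0 \<le> (real T * s i - 1 / 2)\<^sup>2 / real T" by simp
    also have "\<dots> = real T * (s i)\<^sup>2 - s i + 1 / (4 * real T)"
      using T by (simp add: power2_eq_square field_simps)
    finally have "s i \<le> real T * (s i)\<^sup>2 + 1 / (4 * real T)" by simp
    also have "\<dots> \<le> real T * (4 * k i) + 1 / (4 * real T)"
      using T k[of i] by simp
    finally have "w i * s i \<le> w i * (real T * (4 * k i)) + w i * (1 / (4 * real T))"
      using w(1)[of i] by (simp only: mult_left_mono flip: distrib_left)
    moreover have "w i * (1 / (4 * real T)) \<le> 1 * (1 / (4 * real T))"
      using w T by (intro mult_right_mono) auto
    ultimately show "w i * s i \<le> real T * (4 * (w i * k i)) + 1 / (4 * real T)"
      by (simp add: mult_ac)
  qed
  \<comment> \<open>The \<open>T\<close> error terms \<open>1 / (4 * T)\<close> add up to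
    \<open>1 / 4\<close>, half of the available \<open>1 / 2\<close>.\<close>
  also have "\<dots> = 4 * real T * (\<Sum>i=1..T. w i * k i) + 1 / 4"
    using T by (simp add: sum.distrib sum_distrib_left mult_ac)
  finally have "1 / (16 * real T) \<le> (\<Sum>i=1..T. w i * k i)"
    using T by (simp add: field_simps)
  then show ?thesis by (simp add: w_def P_def Q_def mult_ac)
qed

section \<open>Success and collision in a single slot\<close>

definition success_prob :: "nat \<Rightarrow> real \<Rightarrow> real" where
  "success_prob n q = measure_pmf.prob (slot_pmf n q) {f. card {j. j < n \<and> f j} = 1}"

definition collision_prob :: "nat \<Rightarrow> real \<Rightarrow> real" where
  "collision_prob n q = measure_pmf.prob (slot_pmf n q) {f. 2 \<le> card {j. j < n \<and> f j}}"

lemma prob_num_senders: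
  assumes "0 \<le> q" "q \<le> 1"
  shows "measure_pmf.prob (slot_pmf n q) {f. card {j. j < n \<and> f j} \<in> B} =
    measure_pmf.prob (binomial_pmf n q) B"
proof -
  have "binomial_pmf n q = map_pmf (\<lambda>f. card {j\<in>{..<n}. f j}) (slot_pmf n q)"
    unfolding slot_pmf_def using assms by (intro binomial_pmf_altdef') auto
  then show ?thesis by (simp add: vimage_def)
qed

text \<open>Collisions of exactly two senders suffice. The square of
  \<open>n * q * (1 - q) ^ (n - 1)\<close> has the same power of \<open>q\<close> as their
  probability and a higher power of \<open>1 - q\<close>; the coefficients compare by
  \<open>n\<^sup>2 \<le> 2 * n * (n - 1)\<close>, an equality for \<open>n = 2\<close>.\<close>

lemma success_prob_sq_le:
  assumes "0 \<le> q" "q \<le> 1" "2 \<le> n"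
  shows "(success_prob n q)\<^sup>2 \<le> 4 * collision_prob n q"
proof -
  have s: "success_prob n q = real n * q * (1 - q) ^ (n - 1)"
    using prob_num_senders[OF assms(1,2), of n "{1}"] assms(1,2)
    by (simp add: success_prob_def measure_pmf_single)
  have "pmf (binomial_pmf n q) 2 \<le> measure_pmf.prob (binomial_pmf n q) {2..}"
    by (subst measure_pmf_single [symmetric]) (auto intro: measure_pmf.finite_measure_mono)
  then have k: "real (n choose 2) * q\<^sup>2 * (1 - q) ^ (n - 2) \<le> collision_prob n q"
    using prob_num_senders[OF assms(1,2), of n "{2..}"] assms(1,2)
    by (simp add: collision_prob_def)
  have "((1 - q) ^ (n - 1))\<^sup>2 \<le> (1 - q) ^ (n - 2)"
    using assms by (simp add: power_decreasing flip: power_mult)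
  moreover have "(real n)\<^sup>2 \<le> 4 * real (n choose 2)"
  proof -
    have "2 * real (n choose 2) = real n * (real n - 1)"
      using assms(3) by (simp add: choose_two real_of_nat_div)
    moreover have "real n * 2 \<le> real n * real n" using assms(3) by (intro mult_left_mono) auto
    ultimately show ?thesis by (simp add: power2_eq_square algebra_simps)
  qed
  ultimately have "(real n)\<^sup>2 * (q\<^sup>2 * ((1 - q) ^ (n - 1))\<^sup>2) \<le> (4 * real (n choose 2)) * (q\<^sup>2 * (1 - q) ^ (n - 2))"
    using assms by (intro mult_mono) auto
  with k show ?thesis unfolding s by (simp add: power_mult_distrib mult_ac)
qed

text \<open>Success and collision exclude each other, so their probabilities add up to at most 1. A
  success probability above \<open>9 / 10\<close> would force a collision probability of at least
  \<open>81 / 400\<close>, which exceeds the remaining \<open>1 / 10\<close>.\<close>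

lemma success_prob_le:
  assumes "0 \<le> q" "q \<le> 1" "2 \<le> n"
  shows "success_prob n q \<le> 9 / 10"
proof (rule ccontr)
  assume *: "\<not> ?thesis"
  have "success_prob n q + collision_prob n q =
      measure_pmf.prob (slot_pmf n q)
        ({f. card {j. j < n \<and> f j} = 1} \<union> {f. 2 \<le> card {j. j < n \<and> f j}})"
    unfolding success_prob_def collision_prob_def
    by (intro measure_pmf.finite_measure_Union [symmetric]) auto
  then have "success_prob n q + collision_prob n q \<le> 1" by simp
  moreover have "(9 / 10)\<^sup>2 \<le> (success_prob n q)\<^sup>2" using * by (intro power_mono) auto
  then have "81 / 400 \<le> collision_prob n q"
    using success_prob_sq_le[OF assms] by (simp add: power2_eq_square)
  ultimately show False using * by simp
qed

section \<open>Events of a run and their probabilities by independence of the slots\<close>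

lemma measurable_slot:
  assumes "1 \<le> i"
  shows "(\<lambda>\<omega>. \<omega> i) \<in> run_space n q \<rightarrow>\<^sub>M count_space UNIV"
proof -
  have "(\<lambda>\<omega>. \<omega> i) \<in> run_space n q \<rightarrow>\<^sub>M measure_pmf (slot_pmf n (q i))"
    unfolding run_space_def using assms by (intro measurable_component_singleton) auto
  then show ?thesis by simp
qed

lemma slots_sets:
  assumes "finite J" "J \<subseteq> {1..}"
  shows "{\<omega> \<in> space (run_space n q). \<forall>i\<in>J. \<omega> i \<in> B i} \<in> sets (run_space n q)"
proof -
  have "{\<omega> \<in> space (run_space n q). \<omega> i \<in> B i} \<in> sets (run_space n q)" if "i \<in> J" for i
    using measurable_sets[OF measurable_slot, of i "B i" n q] that assms
    by (auto simp: vimage_def Int_def conj_commute)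
  then show ?thesis using assms(1) by (intro sets.sets_Collect_finite_All) auto
qed

lemma prob_slots:
  assumes "finite J" "J \<subseteq> {1..}"
  shows "measure (run_space n q) {\<omega> \<in> space (run_space n q). \<forall>i\<in>J. \<omega> i \<in> B i} =
    (\<Prod>i\<in>J. measure_pmf.prob (slot_pmf n (q i)) (B i))"
proof -
  interpret product_prob_space "\<lambda>i. measure_pmf (slot_pmf n (q i))" "{1..}"
    by unfold_locales
  have "emeasure (run_space n q) {\<omega> \<in> space (run_space n q). \<forall>i\<in>J. \<omega> i \<in> B i} =
      ennreal (\<Prod>i\<in>J. measure_pmf.prob (slot_pmf n (q i)) (B i))"
    unfolding run_space_def using emeasure_PiM_Collect[OF assms(2,1), of B]
    by (simp add: measure_pmf.emeasure_eq_measure prod_ennreal)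
  then show ?thesis by (rule measure_eq_emeasure_eq_ennreal[rotated]) (simp add: prod_nonneg)
qed

lemma prob_space_run_space: "prob_space (run_space n q)"
  unfolding run_space_def by (intro prob_space_PiM prob_space_measure_pmf)

lemma latency_le_iff: "latency n \<omega> \<le> enat t \<longleftrightarrow> (\<exists>i\<in>{1..t}. success n \<omega> i)"
proof
  assume le: "latency n \<omega> \<le> enat t"
  show "\<exists>i\<in>{1..t}. success n \<omega> i"
  proof (rule ccontr)
    assume "\<not> ?thesis"
    \<comment> \<open>This includes runs without any success, as the infimum of the empty set is
      infinite.\<close>
    then have "enat (Suc t) \<le> latency n \<omega>"
      unfolding latency_def by (intro INF_greatest) force
    with le have "enat (Suc t) \<le> enat t" by (rule order_trans[rotated])
    then show False by simp
  qed
next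
  assume "\<exists>i\<in>{1..t}. success n \<omega> i"
  then obtain i where i: "1 \<le> i" "i \<le> t" "success n \<omega> i" by auto
  then have "latency n \<omega> \<le> enat i" unfolding latency_def by (intro INF_lower) auto
  with i show "latency n \<omega> \<le> enat t" by (meson enat_ord_simps(1) order_trans)
qed

text \<open>The collision must be followed by a success, so that the event is part of \<open>solved_within\<close>
  and its cost survives conditioning on it.\<close>

definition useful_collision :: "nat \<Rightarrow> (nat \<Rightarrow> real) \<Rightarrow> nat \<Rightarrow> nat \<Rightarrow> (nat \<Rightarrow> nat \<Rightarrow> bool) set" where
  "useful_collision n q T i =
     {\<omega> \<in> space (run_space n q). (\<forall>j\<in>{1..<i}. \<not> success n \<omega> j) \<and> collision n \<omega> i \<and>
        (\<exists>j\<in>{i<..T}. success n \<omega> j)}"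

text \<open>Independence gives product formulas only for events that constrain each slot separately,
  and a success in some later slot is not of this form. The event is therefore written as a
  difference: a collision in slot \<open>i\<close> and no success in the other slots up to
  \<open>i\<close>, minus the same with no success up to \<open>T\<close>.\<close>

lemma useful_collision:
  assumes "i \<in> {1..T}"
  shows sets_useful_collision: "useful_collision n q T i \<in> sets (run_space n q)" (is ?sets)
    and prob_useful_collision: "measure (run_space n q) (useful_collision n q T i) =
      (\<Prod>j=1..<i. 1 - success_prob n (q j)) * collision_prob n (q i) *
        (1 - (\<Prod>j\<in>{i<..T}. 1 - success_prob n (q j)))" (is ?prob)
proof -
  interpret prob_space "run_space n q" by (rule prob_space_run_space)
  define N where "N = {f. card {j. j < n \<and> f j} \<noteq> 1}"
  define K where "K = {f. 2 \<le> card {j. j < n \<and> f j}}"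
  define B where "B = (\<lambda>j. if j = i then K else N)"
  define X where "X J = {\<omega> \<in> space (run_space n q). \<forall>j\<in>J. \<omega> j \<in> B j}" for J
  have N: "measure_pmf.prob (slot_pmf n r) N = 1 - success_prob n r" for r
    unfolding success_prob_def
    by (subst measure_pmf.prob_compl [symmetric]) (auto simp: N_def intro!: arg_cong[where f = "measure _"])
  have K: "measure_pmf.prob (slot_pmf n r) K = collision_prob n r" for r
    by (simp add: K_def collision_prob_def)
  have X: "X J \<in> events" "prob (X J) = (\<Prod>j\<in>J. measure_pmf.prob (slot_pmf n (q j)) (B j))"
    if "finite J" "J \<subseteq> {1..}" for J
    unfolding X_def using that by (simp_all add: slots_sets prob_slots)
  have i: "1 \<le> i" "i \<le> T" using assms by auto
  have eq: "useful_collision n q T i = X {1..i} - X {1..T}"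
  proof -
    have "{1..i} = insert i {1..<i}" "{1..T} = insert i ({1..<i} \<union> {i<..T})" using i by auto
    then show ?thesis
      by (auto simp: useful_collision_def X_def B_def N_def K_def success_def collision_def
          num_senders_def)
  qed
  have "X {1..T} \<subseteq> X {1..i}" using i by (auto simp: X_def)
  then have "prob (useful_collision n q T i) = prob (X {1..i}) - prob (X {1..T})"
    unfolding eq by (intro finite_measure_Diff X) auto
  also have "prob (X {1..i}) = (\<Prod>j=1..<i. 1 - success_prob n (q j)) * collision_prob n (q i)"
  proof -
    have "{1..i} = insert i {1..<i}" using i by auto
    then have "(\<Prod>j\<in>{1..i}. measure_pmf.prob (slot_pmf n (q j)) (B j)) =
        collision_prob n (q i) * (\<Prod>j\<in>{1..<i}. measure_pmf.prob (slot_pmf n (q j)) (B j))"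
      by (simp add: B_def K)
    also have "(\<Prod>j\<in>{1..<i}. measure_pmf.prob (slot_pmf n (q j)) (B j)) =
        (\<Prod>j\<in>{1..<i}. 1 - success_prob n (q j))"
      by (intro prod.cong) (auto simp: B_def N)
    finally show ?thesis by (subst X(2)) auto
  qed
  also have "prob (X {1..T}) = (\<Prod>j=1..<i. 1 - success_prob n (q j)) * collision_prob n (q i) *
      (\<Prod>j\<in>{i<..T}. 1 - success_prob n (q j))"
  proof -
    have "{1..T} = insert i ({1..<i} \<union> {i<..T})" using i by auto
    then have "(\<Prod>j\<in>{1..T}. measure_pmf.prob (slot_pmf n (q j)) (B j)) =
        collision_prob n (q i) * (\<Prod>j\<in>{1..<i} \<union> {i<..T}. measure_pmf.prob (slot_pmf n (q j)) (B j))"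
      by (simp add: B_def K)
    also have "(\<Prod>j\<in>{1..<i} \<union> {i<..T}. measure_pmf.prob (slot_pmf n (q j)) (B j)) =
        (\<Prod>j\<in>{1..<i} \<union> {i<..T}. 1 - success_prob n (q j))"
      by (intro prod.cong) (auto simp: B_def N)
    also have "\<dots> = (\<Prod>j\<in>{1..<i}. 1 - success_prob n (q j)) * (\<Prod>j\<in>{i<..T}. 1 - success_prob n (q j))"
      by (intro prod.union_disjoint) auto
    finally show ?thesis by (subst X(2)) auto
  qed
  finally show ?prob by (simp add: algebra_simps)
  show ?sets unfolding eq using X(1) by auto
qed

text \<open>The complement demands a failure in each of the first \<open>T\<close> slots, so its
  probability is a product.\<close>

lemma solved_within:
  shows sets_solved_within: "solved_within n q T \<in> sets (run_space n q)" (is ?sets)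
    and prob_solved_within: "measure (run_space n q) (solved_within n q T) =
      1 - (\<Prod>j=1..T. 1 - success_prob n (q j))" (is ?prob)
proof -
  interpret prob_space "run_space n q" by (rule prob_space_run_space)
  define N where "N = {f. card {j. j < n \<and> f j} \<noteq> 1}"
  define X where "X = {\<omega> \<in> space (run_space n q). \<forall>j\<in>{1..T}. \<omega> j \<in> N}"
  have N: "measure_pmf.prob (slot_pmf n r) N = 1 - success_prob n r" for r
    unfolding success_prob_def
    by (subst measure_pmf.prob_compl [symmetric]) (auto simp: N_def intro!: arg_cong[where f = "measure _"])
  have X: "X \<in> events" unfolding X_def by (rule slots_sets) auto
  have "prob X = (\<Prod>j=1..T. 1 - success_prob n (q j))"
    unfolding X_def by (subst prob_slots) (auto simp: N)
  moreover have eq: "solved_within n q T = space (run_space n q) - X"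
    by (auto simp: solved_within_def X_def N_def latency_le_iff success_def num_senders_def)
  ultimately show ?prob using X by (simp add: prob_compl)
  show ?sets unfolding eq using X by auto
qed

section \<open>Lower bounds on the expected collision cost\<close>

text \<open>A useful collision comes strictly before the first success, since neither the earlier
  slots nor the colliding slot itself succeed; hence the cost counts it. The finite sum of
  indicators can be integrated term by term.\<close>

lemma collision_cost_ge:
  assumes "\<omega> \<in> space (run_space n q)"
  shows "(\<Sum>i=1..T. ennreal C * indicator (useful_collision n q T i) \<omega>) \<le> collision_cost C n \<omega>"
proof -
  define I where "I = {i\<in>{1..T}. \<omega> \<in> useful_collision n q T i}"
  have fin: "finite I" by (simp add: I_def)
  have "(\<Sum>i=1..T. indicator (useful_collision n q T i) \<omega> :: ennreal) = of_nat (card I)"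
    unfolding I_def by (simp add: indicator_def sum.If_cases Int_def)
  also have "\<dots> = emeasure (count_space UNIV) I"
    using fin by simp
  also have "\<dots> \<le> emeasure (count_space UNIV) {i. 1 \<le> i \<and> enat i < latency n \<omega> \<and> collision n \<omega> i}"
  proof (intro emeasure_mono subsetI)
    fix i assume i: "i \<in> I"
    have "\<not> success n \<omega> j" if "j \<in> {1..i}" for j
    proof (cases "j = i")
      case True
      with i show ?thesis
        by (auto simp: I_def useful_collision_def collision_def success_def)
    qed (use that i in \<open>auto simp: I_def useful_collision_def\<close>)
    then have "\<not> latency n \<omega> \<le> enat i" by (simp add: latency_le_iff)
    with i show "i \<in> {i. 1 \<le> i \<and> enat i < latency n \<omega> \<and> collision n \<omega> i}"
      by (auto simp: I_def useful_collision_def)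
  qed simp
  finally show ?thesis
    unfolding collision_cost_def sum_distrib_left [symmetric] by (rule mult_left_mono) simp
qed

lemma expected_cost_lower_bounds:
  assumes q: "\<And>i. 0 \<le> q i" "\<And>i. q i \<le> 1" and n: "2 \<le> n" and C: "0 \<le> C"
    and solved: "1 - 1 / 10000 \<le> measure (run_space n q) (solved_within n q T)"
  shows "ennreal (C / (16 * real T)) \<le> expected_cost C n q"
    and "ennreal (C / (16 * real T)) \<le> expected_cost_given (solved_within n q T) C n q"
proof -
  let ?M = "run_space n q" and ?E = "useful_collision n q T" and ?A = "solved_within n q T"
  interpret prob_space ?M by (rule prob_space_run_space)
  have "1 / (16 * real T) \<le> (\<Sum>i=1..T. prob (?E i))"
    using weighted_collision_lower_bound[of "\<lambda>i. success_prob n (q i)" "\<lambda>i. collision_prob n (q i)" T]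
      success_prob_le success_prob_sq_le q n solved
    by (simp add: prob_useful_collision prob_solved_within success_prob_def)
  then have "C * (1 / (16 * real T)) \<le> C * (\<Sum>i=1..T. prob (?E i))"
    using C by (intro mult_left_mono)
  then have le: "C / (16 * real T) \<le> (\<Sum>i=1..T. C * prob (?E i))"
    by (simp add: sum_distrib_left)
  \<comment> \<open>\<open>N\<close> will be the run measure and then its conditioning on
    \<open>?A\<close>; both give each useful collision at least its unconditional
    probability.\<close>
  have general: "ennreal (C / (16 * real T)) \<le> (\<integral>\<^sup>+\<omega>. collision_cost C n \<omega> \<partial>N)"
    if N: "sets N = sets ?M" and E: "\<And>i. i \<in> {1..T} \<Longrightarrow> emeasure ?M (?E i) \<le> emeasure N (?E i)" for N
  proof -
    have meas: "?E i \<in> sets N" if "i \<in> {1..T}" for i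
      using sets_useful_collision[OF that] N by simp
    have "ennreal (C / (16 * real T)) \<le> ennreal (\<Sum>i=1..T. C * prob (?E i))"
      using le by (rule ennreal_leI)
    also have "\<dots> = (\<Sum>i=1..T. ennreal C * emeasure ?M (?E i))"
      using C by (simp add: emeasure_eq_measure ennreal_mult' flip: sum_ennreal)
    also have "\<dots> \<le> (\<Sum>i=1..T. ennreal C * emeasure N (?E i))"
      by (intro sum_mono mult_left_mono E) auto
    also have "\<dots> = (\<Sum>i=1..T. (\<integral>\<^sup>+\<omega>. ennreal C * indicator (?E i) \<omega> \<partial>N))"
      using meas by (intro sum.cong) (auto simp: nn_integral_cmult_indicator)
    also have "\<dots> = (\<integral>\<^sup>+\<omega>. (\<Sum>i=1..T. ennreal C * indicator (?E i) \<omega>) \<partial>N)"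
      using meas by (intro nn_integral_sum [symmetric]) auto
    also have "\<dots> \<le> (\<integral>\<^sup>+\<omega>. collision_cost C n \<omega> \<partial>N)"
      using sets_eq_imp_space_eq[OF N] by (intro nn_integral_mono collision_cost_ge) simp
    finally show ?thesis .
  qed
  show "ennreal (C / (16 * real T)) \<le> expected_cost C n q"
    unfolding expected_cost_def by (rule general) auto
  show "ennreal (C / (16 * real T)) \<le> expected_cost_given ?A C n q"
    unfolding expected_cost_given_def
  proof (rule general)
    fix i assume i: "i \<in> {1..T}"
    \<comment> \<open>A useful collision is followed by a success up to \<open>T\<close>.
      Conditioning on \<open>?A\<close> thus only divides its probability by
      \<open>prob ?A \<le> 1\<close>.\<close>
    have sub: "?A \<inter> ?E i = ?E i"
      using i by (auto simp: useful_collision_def solved_within_def latency_le_iff)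
    have A: "0 < prob ?A" using solved by simp
    have "prob (?E i) * prob ?A \<le> prob (?E i) * 1" by (intro mult_left_mono) auto
    then have "prob (?E i) \<le> prob (?E i) / prob ?A" using A by (simp add: field_simps)
    then have "ennreal (prob (?E i)) \<le> ennreal (prob (?E i)) / ennreal (prob ?A)"
      using A by (simp add: divide_ennreal ennreal_leI)
    then show "emeasure ?M (?E i) \<le> emeasure (uniform_measure ?M ?A) (?E i)"
      using i by (simp add: sets_solved_within sets_useful_collision sub emeasure_eq_measure)
  qed simp
qed

section \<open>Asymptotics in the number of packets\<close>

text \<open>As \<open>\<eta> n\<close> is at least \<open>n\<close>, a failure probability of order
  \<open>\<eta> n powr (- d)\<close> tends to 0 and drops below any constant
  \<open>\<delta>\<close>.\<close>

lemma eventually_solved: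
  fixes \<eta> :: "nat \<Rightarrow> real"
  assumes "whp d \<eta> M A" and d: "d > 0" and \<eta>: "\<And>n. real n \<le> \<eta> n" and \<delta>: "\<delta> > 0"
  shows "\<forall>\<^sub>F n in sequentially. 1 - \<delta> \<le> measure (M n) (A n)"
proof -
  obtain c where c: "c > 0"
    and bnd: "\<forall>\<^sub>F n in sequentially. norm (1 - measure (M n) (A n)) \<le> c * norm (\<eta> n powr (- d))"
    using assms(1) unfolding whp_def by (elim landau_o.bigE)
  have "((\<lambda>n. c * real n powr (- d)) \<longlongrightarrow> c * 0) sequentially"
    using d by (intro tendsto_mult tendsto_const tendsto_neg_powr filterlim_real_sequentially) auto
  then have "\<forall>\<^sub>F n in sequentially. c * real n powr (- d) < \<delta>"
    using \<delta> by (intro order_tendstoD(2)) auto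
  with bnd eventually_gt_at_top[of 0] show ?thesis
  proof eventually_elim
    case (elim n)
    have "c * \<eta> n powr (- d) \<le> c * real n powr (- d)"
      using c d elim(2) \<eta>[of n] by (intro mult_left_mono powr_mono2') auto
    with elim show ?case by simp
  qed
qed

theorem theorem2:
  fixes \<alpha> \<beta> \<epsilon> d :: real
    and \<C> \<eta> :: "nat \<Rightarrow> real"
    and p :: "real \<Rightarrow> nat \<Rightarrow> real"
    and L :: "nat \<Rightarrow> nat"
  assumes "\<epsilon> > 0" and "0 \<le> \<alpha>" and "\<alpha> \<le> 1 / (2 * \<epsilon>)" and "\<beta> \<ge> 0" and "d > 0"
    and "\<And>n. \<C> n \<ge> 4"
    and "\<exists>k::nat. \<C> \<in> O(\<lambda>n. real n ^ k)"
    and "\<And>n. \<eta> n = max (real n) (\<C> n)"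
    and "fair_algorithm p"
    and "(\<lambda>n. real (L n)) \<in> O(\<lambda>n. \<C> n powr (1/2 + \<alpha> * \<epsilon>) * ln (real n) powr \<beta>)"
    and "whp d \<eta> (\<lambda>n. run_space n (p (\<C> n))) (\<lambda>n. solved_within n (p (\<C> n)) (L n))"
  shows "ennreal_bigomega (\<lambda>n. expected_cost (\<C> n) n (p (\<C> n)))
           (\<lambda>n. \<C> n powr (1/2 - \<alpha> * \<epsilon>) / ln (real n) powr \<beta>)
       \<and> ennreal_bigomega
           (\<lambda>n. expected_cost_given (solved_within n (p (\<C> n)) (L n)) (\<C> n) n (p (\<C> n)))
           (\<lambda>n. \<C> n powr (1/2 - \<alpha> * \<epsilon>) / ln (real n) powr \<beta>)"
proof -
  let ?g = "\<lambda>n. \<C> n powr (1/2 - \<alpha> * \<epsilon>) / ln (real n) powr \<beta>"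
  let ?A = "\<lambda>n. solved_within n (p (\<C> n)) (L n)"
  obtain K where K: "K > 0" and
    L: "\<forall>\<^sub>F n in sequentially.
      norm (real (L n)) \<le> K * norm (\<C> n powr (1/2 + \<alpha> * \<epsilon>) * ln (real n) powr \<beta>)"
    using assms(10) by (elim landau_o.bigE)
  have "\<forall>\<^sub>F n in sequentially. 1 - 1 / 10000 \<le> measure (run_space n (p (\<C> n))) (?A n)"
    using assms(5,8,11) by (intro eventually_solved) auto
  \<comment> \<open>From 3 on, \<open>ln n\<close> is positive, and there are the two packets that
    the cost bounds require.\<close>
  with L eventually_ge_at_top[of 3]
  have ev: "\<forall>\<^sub>F n in sequentially.
      ennreal (1 / (16 * K) * ?g n) \<le> expected_cost (\<C> n) n (p (\<C> n)) \<and>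
      ennreal (1 / (16 * K) * ?g n) \<le> expected_cost_given (?A n) (\<C> n) n (p (\<C> n))"
  proof eventually_elim
    case (elim n)
    define l where "l = ln (real n) powr \<beta>"
    have l: "l > 0" using elim(2) by (simp add: l_def)
    have C: "\<C> n > 0" using assms(6)[of n] by simp
    have "measure (run_space n (p (\<C> n))) (?A n) \<noteq> 0" using elim(3) by linarith
    \<comment> \<open>No run is solved within 0 slots.\<close>
    then have L0: "real (L n) > 0"
      by (cases "L n") (auto simp: prob_solved_within)
    \<comment> \<open>The exponents \<open>1/2 - \<alpha> * \<epsilon>\<close> and
      \<open>1/2 + \<alpha> * \<epsilon>\<close> add up to 1, so the claimed rate is
      \<open>\<C> n\<close> divided by the latency bound. The constant combines the latency constant
      \<open>K\<close> with the 16 of the cost bounds.\<close>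
    have "1 / (16 * K) * ?g n = \<C> n / (16 * (K * (\<C> n powr (1/2 + \<alpha> * \<epsilon>) * l)))"
    proof -
      have "\<C> n powr (1/2 - \<alpha> * \<epsilon>) * \<C> n powr (1/2 + \<alpha> * \<epsilon>) = \<C> n"
        using C by (simp flip: powr_add)
      then show ?thesis using K l C by (simp add: field_simps flip: l_def)
    qed
    also have "\<dots> \<le> \<C> n / (16 * real (L n))"
      using elim(1) C L0 l K by (intro divide_left_mono) (auto simp: l_def abs_mult)
    finally have "ennreal (1 / (16 * K) * ?g n) \<le> ennreal (\<C> n / (16 * real (L n)))"
      by (rule ennreal_leI)
    moreover have "ennreal (\<C> n / (16 * real (L n))) \<le> expected_cost (\<C> n) n (p (\<C> n))"
      "ennreal (\<C> n / (16 * real (L n))) \<le> expected_cost_given (?A n) (\<C> n) n (p (\<C> n))"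
      using expected_cost_lower_bounds[of "p (\<C> n)" n "\<C> n" "L n"] assms(9) elim C
      by (auto simp: fair_algorithm_def)
    ultimately show ?case by (meson order_trans)
  qed
  show ?thesis
    unfolding ennreal_bigomega_def
    using K eventually_conj_iff[THEN iffD1, OF ev] by (intro conjI exI[of _ "1 / (16 * K)"]) auto
qed

end
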